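(* For every integer $n\ge 5$, $$\gamma_I(P(n,2))=\begin{cases}\left\lceil\frac{4n}{5}\right\rceil & \text{if } n\equiv 0,3,4 \pmod 5,\\[2pt] \left\lceil\frac{4n}{5}\right\rceil+1 & \text{if } n\equiv 1,2 \pmod 5.\end{cases}$$
   Context: $P(n,k)$ (with $n\ge 3$, $1\le k<n/2$) denotes the generalized Petersen graph: the 3-regular simple graph on the $2n$ vertices $v_0,v_1,\dots,v_{2n-1}$ (subscripts read modulo $2n$) with edges $v_{2i}v_{2i+2}$, $v_{2i}v_{2i+1}$ and $v_{2i+1}v_{2i+1+2k}$ for $0\le i\le n-1$. For a graph $G=(V,E)$, an Italian dominating function (IDF) of $G$ is a function $f:V\to\{0,1,2\}$ such that every $v\in V$ with $f(v)=0$ satisfies $\sum_{u\in N(v)}f(u)\ge 2$, where $N(v)$ is the open neighborhood of $v$. Its weight is $w(f)=\sum_{v\in V}f(v)$, and the Italian domination number is $\gamma_I(G)=\min_f w(f)$ over all IDFs $f$ of $G$. *)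

theory Defs
  imports Complex_Main "Graph_Theory.Graph_Theory"
begin

text \<open>
  The vertex \<open>v\<^sub>j\<close> is the number \<open>j < 2n\<close>, so the even numbers form the outer cycle and the odd
  ones the inner cycles. Every undirected edge is represented by its two opposite arcs, as usual
  for \<^locale>\<open>pair_graph\<close>.
\<close>

definition gen_petersen_edges :: "nat \<Rightarrow> nat \<Rightarrow> (nat \<times> nat) set" where
  "gen_petersen_edges n k =
     {(2 * i, (2 * i + 2) mod (2 * n)) | i. i < n} \<union>
     {(2 * i, 2 * i + 1) | i. i < n} \<union>
     {(2 * i + 1, (2 * i + 1 + 2 * k) mod (2 * n)) | i. i < n}"

definition gen_petersen :: "nat \<Rightarrow> nat \<Rightarrow> nat pair_pre_digraph" where
  "gen_petersen n k =
     \<lparr> pverts = {..<2 * n},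
       parcs = gen_petersen_edges n k \<union> (gen_petersen_edges n k)\<inverse> \<rparr>"

definition open_nbhd :: "'a pair_pre_digraph \<Rightarrow> 'a \<Rightarrow> 'a set" where
  "open_nbhd G v = {u. (v, u) \<in> parcs G}"

text \<open>
  Only the values of \<open>f\<close> on the vertices matter; outside the vertex set it is arbitrary.
\<close>

definition italian_dominating :: "'a pair_pre_digraph \<Rightarrow> ('a \<Rightarrow> nat) \<Rightarrow> bool" where
  "italian_dominating G f \<longleftrightarrow>
     f \<in> pverts G \<rightarrow> {0, 1, 2} \<and>
     (\<forall>v \<in> pverts G. f v = 0 \<longrightarrow> (\<Sum>u \<in> open_nbhd G v. f u) \<ge> 2)"

definition idf_weight :: "'a pair_pre_digraph \<Rightarrow> ('a \<Rightarrow> nat) \<Rightarrow> nat" where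
  "idf_weight G f = (\<Sum>v \<in> pverts G. f v)"

definition italian_domination_number :: "'a pair_pre_digraph \<Rightarrow> nat" where
  "italian_domination_number G = Min {idf_weight G f | f. italian_dominating G f}"

lemma finite_idf_weights:
  assumes "finite (pverts G)"
  shows "finite {idf_weight G f | f. italian_dominating G f}"
proof (rule finite_subset)
  show "{idf_weight G f | f. italian_dominating G f} \<subseteq> {..2 * card (pverts G)}"
  proof clarsimp
    fix f assume "italian_dominating G f"
    hence "f v \<le> 2" if "v \<in> pverts G" for v
      using that by (force simp: italian_dominating_def Pi_iff)
    hence "idf_weight G f \<le> (\<Sum>v \<in> pverts G. 2)"
      unfolding idf_weight_def by (intro sum_mono)
    thus "idf_weight G f \<le> 2 * card (pverts G)" by simp
  qed
qed simp

lemma idf_weights_nonempty: "{idf_weight G f | f. italian_dominating G f} \<noteq> {}"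
proof -
  have "italian_dominating G (\<lambda>_. 2)" by (auto simp: italian_dominating_def)
  thus ?thesis by blast
qed

lemma pair_graph_gen_petersen:
  assumes "3 \<le> n" "1 \<le> k" "2 * k < n"
  shows "pair_graph (gen_petersen n k)"
proof -
  let ?E = "gen_petersen_edges n k"
  have shift: "(x + d) mod m \<noteq> x" if "0 < d" "d < m" "x < m" for x d m :: nat
  proof (cases "x + d < m")
    case False
    with that have "(x + d) mod m = x + d - m" by (simp add: le_mod_geq)
    with that False show ?thesis by simp
  qed (use that in simp)
  have E: "fst e < 2 * n \<and> snd e < 2 * n \<and> fst e \<noteq> snd e" if "e \<in> ?E" for e
  proof -
    from that consider
        i where "i < n" "e = (2 * i, (2 * i + 2) mod (2 * n))"
      | i where "i < n" "e = (2 * i, 2 * i + 1)"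
      | i where "i < n" "e = (2 * i + 1, (2 * i + 1 + 2 * k) mod (2 * n))"
      unfolding gen_petersen_edges_def by blast
    thus ?thesis
    proof cases
      case 1
      with assms shift[of 2 "2 * n" "2 * i"] show ?thesis by simp
    next
      case 2
      thus ?thesis by simp
    next
      case 3
      with assms shift[of "2 * k" "2 * n" "2 * i + 1"] show ?thesis by simp
    qed
  qed
  have fin: "finite (?E \<union> ?E\<inverse>)"
    by (rule finite_subset[of _ "{..<2 * n} \<times> {..<2 * n}"]) (auto dest!: E)
  show ?thesis
    by unfold_locales
      (use fin in \<open>auto simp: gen_petersen_def symmetric_def sym_def dest!: E\<close>)
qed

end

theory Submission
  imports Defs
begin

text \<open>
  The \<^emph>\<open>excess\<close> of an Italian dominating function \<open>f\<close> at a vertex \<open>v\<close> is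
  \<open>f(N(v)) + 2 f(v) - 2\<close>. It is nonnegative: a vertex of value 0 receives at least 2 from its
  neighbours, and any other vertex pays for itself. Summed over a cubic graph, each value is counted
  three times by the neighbourhoods and twice by the vertex, so in \<open>P(n,2)\<close> a function of weight
  \<open>w\<close> has total excess \<open>e = 5w - 4n\<close> (\<open>five_times_weight\<close>). Hence \<open>w \<ge> 4n/5\<close>, and
  \<open>e\<close> is congruent to \<open>n\<close> modulo 5.

  For \<open>n \<equiv> 1\<close> and \<open>n \<equiv> 2\<close> modulo 5, weight \<open>\<lceil>4n/5\<rceil>\<close> would mean total excess 1 or 2. This is
  impossible because, for \<open>n \<ge> 6\<close>, a total excess of at most 2 is already 0
  (\<open>low_excess.total_excess_eq_0\<close>). Indeed, so little slack rules out the value 2, and then an edge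
  with both ends of value 1: either would use up the whole excess of 2, so that every other vertex
  receives exactly what it needs, and a few steps of forced values along the cycle lead to a vertex
  that cannot be dominated exactly. Once the vertices of value 1 are independent, positive excess can only
  occur at a vertex of value 0 with three neighbours of value 1, and following the forced values
  excludes this configuration as well.

  The bound is attained by repeating the excess-free pattern of five columns
  (outer value above inner value)
  \<open>1 0 1 0 0\<close> over \<open>0 0 0 1 1\<close>, with the inner values of the last two columns set to 1 to close
  the seam when 5 does not divide \<open>n\<close>, and the last outer value dropped if \<open>n \<equiv> 3\<close> modulo 5
  (\<open>optimal_idf\<close>).
\<close>

section \<open>The excess of an Italian dominating function\<close>

text \<open>
  For an Italian dominating function the subtraction on natural numbers does not truncate; this is
  \<open>excess_eq\<close>.
\<close>

definition excess :: "'a pair_pre_digraph \<Rightarrow> ('a \<Rightarrow> nat) \<Rightarrow> 'a \<Rightarrow> nat" where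
  "excess G f v = (\<Sum>u\<in>open_nbhd G v. f u) + 2 * f v - 2"

lemma excess_eq:
  assumes "italian_dominating G f" "v \<in> pverts G"
  shows "excess G f v + 2 = (\<Sum>u\<in>open_nbhd G v. f u) + 2 * f v"
  using assms by (cases "f v = 0") (auto simp: italian_dominating_def excess_def)

text \<open>
  Double counting: every value \<open>f u\<close> occurs in the neighbourhood sums of the three neighbours
  of \<open>u\<close>.
\<close>

lemma weight_eq_sum_excess:
  assumes G: "pair_graph G"
    and cubic: "\<And>v. v \<in> pverts G \<Longrightarrow> card (open_nbhd G v) = 3"
    and f: "italian_dominating G f"
  shows "5 * idf_weight G f = 2 * card (pverts G) + (\<Sum>v\<in>pverts G. excess G f v)"
proof -
  interpret pair_graph G by (fact G)
  let ?V = "pverts G"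
  have nbhd: "open_nbhd G v = {u \<in> ?V. (v, u) \<in> parcs G}" for v
    using in_arcsD2 by (auto simp: open_nbhd_def)
  have "(\<Sum>v\<in>?V. \<Sum>u\<in>open_nbhd G v. f u)
      = (\<Sum>u\<in>?V. \<Sum>v\<in>{v \<in> ?V. (v, u) \<in> parcs G}. f u)"
    unfolding nbhd by (rule sum.swap_restrict) auto
  also have "\<dots> = (\<Sum>u\<in>?V. card (open_nbhd G u) * f u)"
    by (intro sum.cong refl) (auto simp: nbhd intro!: arg_cong[of _ _ card] arcs_symmetric)
  also have "\<dots> = 3 * idf_weight G f"
    by (simp add: cubic idf_weight_def sum_distrib_left)
  finally have nb: "(\<Sum>v\<in>?V. \<Sum>u\<in>open_nbhd G v. f u) = 3 * idf_weight G f" .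
  have "(\<Sum>v\<in>?V. excess G f v) + 2 * card ?V = (\<Sum>v\<in>?V. excess G f v + 2)"
    by (simp only: sum.distrib sum_constant) simp
  also have "\<dots> = (\<Sum>v\<in>?V. (\<Sum>u\<in>open_nbhd G v. f u) + 2 * f v)"
    by (intro sum.cong refl excess_eq f)
  also have "\<dots> = 5 * idf_weight G f"
    by (simp add: sum.distrib nb idf_weight_def flip: sum_distrib_left)
  finally show ?thesis by simp
qed

section \<open>Cyclic coordinates\<close>

text \<open>
  Indexing both kinds of vertices by all integers, with period \<open>n\<close>, makes the local arguments
  translation invariant and free of case distinctions at the seam between column \<open>n - 1\<close> and
  column 0.
\<close>

definition outer :: "nat \<Rightarrow> int \<Rightarrow> nat" where
  "outer n i = 2 * nat (i mod int n)"

definition inner :: "nat \<Rightarrow> int \<Rightarrow> nat" where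
  "inner n i = 2 * nat (i mod int n) + 1"

lemma outer_eq_iff: "n > 0 \<Longrightarrow> outer n i = outer n j \<longleftrightarrow> i mod int n = j mod int n"
  by (simp add: outer_def eq_nat_nat_iff)

lemma inner_eq_iff: "n > 0 \<Longrightarrow> inner n i = inner n j \<longleftrightarrow> i mod int n = j mod int n"
  by (simp add: inner_def eq_nat_nat_iff)

lemma outer_neq_inner [simp]: "outer n i \<noteq> inner n j" "inner n j \<noteq> outer n i"
  unfolding outer_def inner_def by (metis even_mult_iff even_plus_one_iff even_numeral)+

lemma mod_neq:
  fixes i j m :: int
  assumes "i \<noteq> j" "\<bar>i - j\<bar> < m"
  shows "i mod m \<noteq> j mod m"
proof
  assume "i mod m = j mod m"
  hence "m dvd i - j" by (simp add: mod_eq_dvd_iff)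
  with assms zdvd_imp_le[of m "\<bar>i - j\<bar>"] show False by simp
qed

lemma outer_of_nat: "i < n \<Longrightarrow> outer n (int i) = 2 * i"
  by (simp add: outer_def)

lemma inner_of_nat: "i < n \<Longrightarrow> inner n (int i) = 2 * i + 1"
  by (simp add: inner_def)

lemma pverts_gen_petersen:
  assumes "n > 0"
  shows "pverts (gen_petersen n k) = range (outer n) \<union> range (inner n)"
proof (intro equalityI subsetI)
  fix v assume v: "v \<in> pverts (gen_petersen n k)"
  hence "v div 2 < n" by (auto simp: gen_petersen_def)
  hence "v = outer n (int (v div 2)) \<or> v = inner n (int (v div 2))"
    unfolding outer_of_nat[OF \<open>v div 2 < n\<close>] inner_of_nat[OF \<open>v div 2 < n\<close>] by presburger
  thus "v \<in> range (outer n) \<union> range (inner n)" by blast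
next
  have "nat (i mod int n) < n" for i
    using assms by (simp add: nat_less_iff)
  hence "outer n i < 2 * n" "inner n i < 2 * n" for i
    unfolding outer_def inner_def by (simp, metis Suc_double_not_eq_double Suc_eq_plus1 Suc_lessI
      add_less_mono mult_2)
  thus "v \<in> pverts (gen_petersen n k)" if "v \<in> range (outer n) \<union> range (inner n)" for v
    using that by (auto simp: gen_petersen_def)
qed

lemma gen_petersen_edges_cyclic:
  assumes "n > 0"
  shows "gen_petersen_edges n k =
    (\<Union>i. {(outer n i, outer n (i + 1)), (outer n i, inner n i), (inner n i, inner n (i + int k))})"
    (is "_ = (\<Union>i. ?E i)")
proof -
  have shift: "outer n (int i + 1) = (2 * i + 2) mod (2 * n)"
              "inner n (int i + int k) = (2 * i + 1 + 2 * k) mod (2 * n)" for i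
  proof -
    have "nat ((int i + 1) mod int n) = (i + 1) mod n"
      by (simp add: nat_mod_distrib nat_add_distrib)
    thus "outer n (int i + 1) = (2 * i + 2) mod (2 * n)"
      by (simp add: outer_def mult_mod_right)
    have "nat ((int i + int k) mod int n) = (i + k) mod n"
      by (simp add: nat_mod_distrib nat_add_distrib)
    moreover have "(2 * i + 1 + 2 * k) mod (2 * n) = 2 * ((i + k) mod n) + 1"
      using mod_mult2_eq[of "2 * i + 1 + 2 * k" 2 n] by simp
    ultimately show "inner n (int i + int k) = (2 * i + 1 + 2 * k) mod (2 * n)"
      by (simp add: inner_def)
  qed
  have "gen_petersen_edges n k = (\<Union>i<n.
    {(2 * i, (2 * i + 2) mod (2 * n)), (2 * i, 2 * i + 1), (2 * i + 1, (2 * i + 1 + 2 * k) mod (2 * n))})"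
    unfolding gen_petersen_edges_def by blast
  also have "\<dots> = (\<Union>i<n. ?E (int i))"
    by (intro SUP_cong refl) (simp add: shift outer_of_nat inner_of_nat)
  also have "\<dots> = (\<Union>i. ?E i)"
  proof (intro equalityI UN_least)
    fix i :: int
    have "?E (int (nat (i mod int n))) = ?E i"
      using assms by (simp add: outer_def inner_def mod_simps)
    moreover have "nat (i mod int n) < n"
      using assms by (simp add: nat_less_iff)
    ultimately show "?E i \<subseteq> (\<Union>i<n. ?E (int i))" by blast
  qed blast
  finally show ?thesis .
qed

lemma open_nbhd_outer:
  assumes "n > 0"
  shows "open_nbhd (gen_petersen n k) (outer n i) = {outer n (i - 1), outer n (i + 1), inner n i}"
proof (intro equalityI subsetI)
  have cong: "outer n (j + d) = outer n (i + d)" "inner n j = inner n i" if "outer n j = outer n i" for j d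
    using that assms by (auto simp: outer_eq_iff inner_eq_iff intro: mod_add_cong)
  fix u assume "u \<in> open_nbhd (gen_petersen n k) (outer n i)"
  then consider
      j where "outer n i = outer n j" "u = outer n (j + 1)"
    | j where "outer n i = outer n j" "u = inner n j"
    | j where "outer n i = outer n (j + 1)" "u = outer n j"
    unfolding open_nbhd_def gen_petersen_def gen_petersen_edges_cyclic[OF assms] by auto
  thus "u \<in> {outer n (i - 1), outer n (i + 1), inner n i}"
  proof cases
    case (1 j)
    thus ?thesis using cong(1)[of j "1"] by simp
  next
    case (2 j)
    thus ?thesis using cong(2)[of j] by simp
  next
    case (3 j)
    thus ?thesis using cong(1)[of "j + 1" "- 1"] by simp
  qed
next
  have E: "(outer n j, outer n (j + 1)) \<in> gen_petersen_edges n k"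
    "(outer n j, inner n j) \<in> gen_petersen_edges n k" for j
    unfolding gen_petersen_edges_cyclic[OF assms] by blast+
  fix u assume "u \<in> {outer n (i - 1), outer n (i + 1), inner n i}"
  thus "u \<in> open_nbhd (gen_petersen n k) (outer n i)"
    using E(1)[of i] E(1)[of "i - 1"] E(2)[of i] by (auto simp: open_nbhd_def gen_petersen_def)
qed

lemma open_nbhd_inner:
  assumes "n > 0"
  shows "open_nbhd (gen_petersen n k) (inner n i) = {inner n (i - int k), inner n (i + int k), outer n i}"
proof (intro equalityI subsetI)
  have cong: "inner n (j + d) = inner n (i + d)" "outer n j = outer n i" if "inner n j = inner n i" for j d
    using that assms by (auto simp: outer_eq_iff inner_eq_iff intro: mod_add_cong)
  fix u assume "u \<in> open_nbhd (gen_petersen n k) (inner n i)"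
  then consider
      j where "inner n i = inner n j" "u = inner n (j + int k)"
    | j where "inner n i = inner n j" "u = outer n j"
    | j where "inner n i = inner n (j + int k)" "u = inner n j"
    unfolding open_nbhd_def gen_petersen_def gen_petersen_edges_cyclic[OF assms] by auto
  thus "u \<in> {inner n (i - int k), inner n (i + int k), outer n i}"
  proof cases
    case (1 j)
    thus ?thesis using cong(1)[of j "int k"] by simp
  next
    case (2 j)
    thus ?thesis using cong(2)[of j] by simp
  next
    case (3 j)
    thus ?thesis using cong(1)[of "j + int k" "- int k"] by simp
  qed
next
  have E: "(inner n j, inner n (j + int k)) \<in> gen_petersen_edges n k"
    "(outer n j, inner n j) \<in> gen_petersen_edges n k" for j
    unfolding gen_petersen_edges_cyclic[OF assms] by blast+
  fix u assume "u \<in> {inner n (i - int k), inner n (i + int k), outer n i}"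
  thus "u \<in> open_nbhd (gen_petersen n k) (inner n i)"
    using E(1)[of i] E(1)[of "i - int k"] E(2)[of i] by (auto simp: open_nbhd_def gen_petersen_def)
qed

lemma sum_open_nbhd_outer:
  assumes "n \<ge> 3"
  shows "(\<Sum>u\<in>open_nbhd (gen_petersen n k) (outer n i). h u) =
    h (outer n (i - 1)) + h (outer n (i + 1)) + (h (inner n i) :: 'a :: comm_monoid_add)"
proof -
  have "outer n (i - 1) \<noteq> outer n (i + 1)"
    using assms mod_neq[of "i - 1" "i + 1" "int n"] by (simp add: outer_eq_iff)
  thus ?thesis using assms by (simp add: open_nbhd_outer add.assoc)
qed

lemma sum_open_nbhd_inner:
  assumes "0 < k" "2 * k < n"
  shows "(\<Sum>u\<in>open_nbhd (gen_petersen n k) (inner n i). h u) =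
    h (inner n (i - int k)) + h (inner n (i + int k)) + (h (outer n i) :: 'a :: comm_monoid_add)"
proof -
  have "inner n (i - int k) \<noteq> inner n (i + int k)"
    using assms mod_neq[of "i - int k" "i + int k" "int n"] by (simp add: inner_eq_iff)
  thus ?thesis using assms by (simp add: open_nbhd_inner add.assoc)
qed

lemma five_times_weight:
  assumes "n \<ge> 5" "italian_dominating (gen_petersen n 2) f"
  shows "5 * idf_weight (gen_petersen n 2) f =
    4 * n + (\<Sum>v\<in>pverts (gen_petersen n 2). excess (gen_petersen n 2) f v)"
proof -
  have "card (open_nbhd (gen_petersen n 2) v) = 3" if "v \<in> pverts (gen_petersen n 2)" for v
    using that assms sum_open_nbhd_outer[of n "\<lambda>_. 1::nat" 2] sum_open_nbhd_inner[of 2 n "\<lambda>_. 1::nat"]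
    by (auto simp: pverts_gen_petersen)
  moreover have "card (pverts (gen_petersen n 2)) = 2 * n"
    by (simp add: gen_petersen_def)
  ultimately show ?thesis
    using assms weight_eq_sum_excess[of "gen_petersen n 2" f] pair_graph_gen_petersen[of n 2] by simp
qed

section \<open>Small total excess vanishes\<close>

text \<open>
  The equation arises at an excess-free vertex of value \<open>y\<close> that has only one neighbour,
  of value \<open>x\<close>, not yet known to have value 0: a single neighbour of value at most 1 cannot
  dominate a vertex of value 0.
\<close>

lemma two_as_sum:
  fixes x y :: nat
  assumes "x + 2 * y = 2" "x \<le> 1"
  shows "y = 1"
  using assms by presburger

text \<open>
  The lower bound on \<open>n\<close> makes vertices of the same kind distinct when their indices differ by
  at most 5, which covers all the vertices that the local arguments must tell apart.
\<close>

locale low_excess =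
  fixes n :: nat and f :: "nat \<Rightarrow> nat"
  assumes n: "n \<ge> 6"
    and idf: "italian_dominating (gen_petersen n 2) f"
    and total: "(\<Sum>v\<in>pverts (gen_petersen n 2). excess (gen_petersen n 2) f v) \<le> 2"
begin

abbreviation "V \<equiv> pverts (gen_petersen n 2)"
abbreviation "p \<equiv> excess (gen_petersen n 2) f"
abbreviation "a i \<equiv> f (outer n i)"
abbreviation "b i \<equiv> f (inner n i)"

lemma vertex [simp]: "outer n i \<in> V" "inner n i \<in> V"
  using n by (simp_all add: pverts_gen_petersen)

lemma outer_neq [simp]: "i \<noteq> j \<Longrightarrow> \<bar>i - j\<bar> < 6 \<Longrightarrow> outer n i \<noteq> outer n j"
  using n mod_neq[of i j "int n"] by (simp add: outer_eq_iff)

lemma inner_neq [simp]: "i \<noteq> j \<Longrightarrow> \<bar>i - j\<bar> < 6 \<Longrightarrow> inner n i \<noteq> inner n j"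
  using n mod_neq[of i j "int n"] by (simp add: inner_eq_iff)

lemma excess_outer: "a (i - 1) + a (i + 1) + b i + 2 * a i = p (outer n i) + 2"
  using excess_eq[OF idf vertex(1)[of i]] n by (simp add: sum_open_nbhd_outer)

lemma excess_inner: "b (i - 2) + b (i + 2) + a i + 2 * b i = p (inner n i) + 2"
  using excess_eq[OF idf vertex(2)[of i]] n by (simp add: sum_open_nbhd_inner)

lemma sum_excess_le:
  assumes "W \<subseteq> V"
  shows "(\<Sum>v\<in>W. p v) \<le> 2"
proof -
  have "(\<Sum>v\<in>W. p v) \<le> (\<Sum>v\<in>V. p v)"
    using assms by (intro sum_mono2) (auto simp: gen_petersen_def)
  with total show ?thesis by simp
qed

lemma two_excesses: "u \<in> V \<Longrightarrow> v \<in> V \<Longrightarrow> u \<noteq> v \<Longrightarrow> p u + p v \<le> 2"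
  using sum_excess_le[of "{u, v}"] by simp

lemma three_excesses:
  "u \<in> V \<Longrightarrow> v \<in> V \<Longrightarrow> w \<in> V \<Longrightarrow> u \<noteq> v \<Longrightarrow> u \<noteq> w \<Longrightarrow> v \<noteq> w \<Longrightarrow> p u + p v + p w \<le> 2"
  using sum_excess_le[of "{u, v, w}"] by simp

text \<open>
  A vertex of value 2 takes all the excess, so its neighbours have value 0 and are themselves
  exactly dominated, which makes their other neighbours 0 too. The vertex two steps further along
  the outer cycle can then only be dominated by a second vertex of value 2.
\<close>

lemma outer_le_1: "a i \<le> 1"
proof (rule ccontr)
  assume "\<not> a i \<le> 1"
  hence i: "p (outer n i) \<ge> 2" "a i \<ge> 2" using excess_outer[of i] by auto
  have exact: "p v = 0" if "v \<in> V" "outer n i \<noteq> v" for v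
    using two_excesses[of "outer n i" v] that i by simp
  have "p (inner n i) = 0" "p (outer n (i + 1)) = 0" "p (outer n (i + 2)) = 0"
    "p (outer n (i + 3)) = 0" by (simp_all add: exact)
  \<comment> \<open>The commuted sum brings every index into the form \<open>i + c\<close>; likewise in the proofs below.\<close>
  thus False
    using i excess_inner[of i] excess_outer[of "i + 1"] excess_outer[of "i + 2"]
      excess_outer[of "i + 3"] by (simp add: add.commute[of _ i])
qed

text \<open>
  As on the outer cycle, except that here the second vertex of value 2 is forced at the inner
  vertex \<open>i + 1\<close>, the only possible support of the outer vertex \<open>i + 1\<close>.
\<close>

lemma inner_le_1: "b i \<le> 1"
proof (rule ccontr)
  assume "\<not> b i \<le> 1"
  hence i: "p (inner n i) \<ge> 2" "b i \<ge> 2" using excess_inner[of i] by auto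
  have exact: "p v = 0" if "v \<in> V" "inner n i \<noteq> v" for v
    using two_excesses[of "inner n i" v] that i by simp
  have "p (outer n i) = 0" "p (outer n (i + 1)) = 0" "p (inner n (i + 1)) = 0"
    "p (inner n (i + 2)) = 0" by (simp_all add: exact)
  thus False
    using i excess_outer[of i] excess_outer[of "i + 1"] excess_inner[of "i + 1"]
      excess_inner[of i] excess_inner[of "i + 2"] by (simp add: add.commute[of _ i])
qed

text \<open>
  Both ends of an edge with positive values have positive excess, so they have excess 1 each and
  all other vertices are exactly dominated. Here the inner vertices \<open>i - 1\<close> and \<open>i + 2\<close> lose two of
  their three neighbours and must have value 1. Exactness at the inner vertex \<open>i + 1\<close> and at
  the outer vertex \<open>i + 2\<close> then makes the inner and the outer vertex \<open>i + 3\<close> zero, which leaves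
  the inner vertex \<open>i + 3\<close> with one neighbour that could dominate it.
\<close>

lemma no_outer_edge: "a i = 0 \<or> a (i + 1) = 0"
proof (rule ccontr)
  assume "\<not> ?thesis"
  hence edge: "a i = 1" "a (i + 1) = 1"
    using outer_le_1[of i] outer_le_1[of "i + 1"] by linarith+
  have pos: "1 \<le> p (outer n i)" "1 \<le> p (outer n (i + 1))"
    using edge excess_outer[of i] excess_outer[of "i + 1"] by simp_all
  hence ends: "p (outer n i) = 1" "p (outer n (i + 1)) = 1"
    using two_excesses[of "outer n i" "outer n (i + 1)"] by simp_all
  have exact: "p v = 0" if "v \<in> V" "outer n i \<noteq> v" "outer n (i + 1) \<noteq> v" for v
    using three_excesses[of "outer n i" "outer n (i + 1)" v] that pos by simp
  have zero: "a (i - 1) = 0" "b i = 0" "a (i + 2) = 0" "b (i + 1) = 0"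
    using ends edge excess_outer[of i] excess_outer[of "i + 1"] by (simp_all add: add.commute[of _ i])
  have 1: "b (i - 2) + b (i + 2) = 1" "b (i - 1) + b (i + 3) = 1"
    "a (i - 2) + b (i - 1) = 1" "a (i + 3) + b (i + 2) = 1"
    using exact[of "inner n i"] exact[of "inner n (i + 1)"] exact[of "outer n (i - 1)"]
      exact[of "outer n (i + 2)"] excess_inner[of i] excess_inner[of "i + 1"]
      excess_outer[of "i - 1"] excess_outer[of "i + 2"] edge zero by (simp_all add: add.commute[of _ i])
  have 2: "b (i - 3) + 2 * b (i - 1) = 2" "b (i + 4) + 2 * b (i + 2) = 2"
    "b (i + 5) + a (i + 3) + 2 * b (i + 3) = 2"
    using exact[of "inner n (i - 1)"] exact[of "inner n (i + 2)"] exact[of "inner n (i + 3)"]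
      excess_inner[of "i - 1"] excess_inner[of "i + 2"] excess_inner[of "i + 3"] edge zero
    by (simp_all add: add.commute[of _ i])
  have "b (i - 1) = 1" "b (i + 2) = 1"
    using two_as_sum[OF 2(1)] two_as_sum[OF 2(2)] inner_le_1 by blast+
  hence "b (i + 5) = 2" using 1 2(3) by simp
  thus False using inner_le_1[of "i + 5"] by simp
qed

text \<open>
  The same slack argument: the outer vertices \<open>i - 2\<close> and \<open>i + 2\<close> must have value 1, so the inner
  vertices \<open>i - 1\<close> and \<open>i + 1\<close> have value 0, and the latter is left with one neighbour
  that could dominate it.
\<close>

lemma no_spoke_edge: "a i = 0 \<or> b i = 0"
proof (rule ccontr)
  assume "\<not> ?thesis"
  hence edge: "a i = 1" "b i = 1"
    using outer_le_1[of i] inner_le_1[of i] by linarith+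
  have pos: "1 \<le> p (outer n i)" "1 \<le> p (inner n i)"
    using edge excess_outer[of i] excess_inner[of i] by simp_all
  hence ends: "p (outer n i) = 1" "p (inner n i) = 1"
    using two_excesses[of "outer n i" "inner n i"] by simp_all
  have exact: "p v = 0" if "v \<in> V" "outer n i \<noteq> v" "inner n i \<noteq> v" for v
    using three_excesses[of "outer n i" "inner n i" v] that pos by simp
  have zero: "a (i - 1) = 0" "a (i + 1) = 0" "b (i - 2) = 0" "b (i + 2) = 0"
    using ends edge excess_outer[of i] excess_inner[of i] by (simp_all add: add.commute[of _ i])
  have 1: "a (i - 2) + b (i - 1) = 1" "a (i + 2) + b (i + 1) = 1"
    "b (i - 1) + b (i + 3) + 2 * b (i + 1) = 2"
    "a (i - 3) + 2 * a (i - 2) = 2" "a (i + 3) + 2 * a (i + 2) = 2"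
    using exact[of "outer n (i - 1)"] exact[of "outer n (i + 1)"] exact[of "inner n (i + 1)"]
      exact[of "outer n (i - 2)"] exact[of "outer n (i + 2)"]
      excess_outer[of "i - 1"] excess_outer[of "i + 1"]
      excess_inner[of "i + 1"] excess_outer[of "i - 2"] excess_outer[of "i + 2"] edge zero
    by (simp_all add: add.commute[of _ i])
  have "a (i - 2) = 1" "a (i + 2) = 1"
    using two_as_sum[OF 1(4)] two_as_sum[OF 1(5)] outer_le_1 by blast+
  hence "b (i + 3) = 2" using 1(1-3) by simp
  thus False using inner_le_1[of "i + 3"] by simp
qed

text \<open>
  Here the outer vertex \<open>i + 1\<close> is forced to have value 1, hence its two outer neighbours are
  exactly dominated by \<open>i + 1\<close> and their own inner neighbours. So the outer vertices \<open>i - 1\<close> and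
  \<open>i + 3\<close> have value 0, which in turn forces the inner vertices \<open>i - 1\<close> and \<open>i + 3\<close> to value 1, so the inner vertex \<open>i + 1\<close> is dominated three times,
  although it should have excess 0.
\<close>

lemma no_inner_edge: "b i = 0 \<or> b (i + 2) = 0"
proof (rule ccontr)
  assume "\<not> ?thesis"
  hence edge: "b i = 1" "b (i + 2) = 1"
    using inner_le_1[of i] inner_le_1[of "i + 2"] by linarith+
  have pos: "1 \<le> p (inner n i)" "1 \<le> p (inner n (i + 2))"
    using edge excess_inner[of i] excess_inner[of "i + 2"] by simp_all
  hence ends: "p (inner n i) = 1" "p (inner n (i + 2)) = 1"
    using two_excesses[of "inner n i" "inner n (i + 2)"] by simp_all
  have exact: "p v = 0" if "v \<in> V" "inner n i \<noteq> v" "inner n (i + 2) \<noteq> v" for v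
    using three_excesses[of "inner n i" "inner n (i + 2)" v] that pos by simp
  have zero: "a i = 0" "a (i + 2) = 0"
    using ends edge excess_inner[of i] excess_inner[of "i + 2"] by (simp_all add: add.commute[of _ i])
  have 1: "b (i + 1) + 2 * a (i + 1) = 2"
    "a (i - 1) + a (i + 1) = 1" "a (i + 1) + a (i + 3) = 1"
    "a (i - 2) + b (i - 1) + 2 * a (i - 1) = 2" "a (i + 4) + b (i + 3) + 2 * a (i + 3) = 2"
    "b (i - 1) + b (i + 3) + a (i + 1) + 2 * b (i + 1) = 2"
    using exact[of "outer n (i + 1)"] exact[of "outer n i"] exact[of "outer n (i + 2)"]
      exact[of "outer n (i - 1)"] exact[of "outer n (i + 3)"] exact[of "inner n (i + 1)"]
      excess_outer[of "i + 1"] excess_outer[of i] excess_outer[of "i + 2"]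
      excess_outer[of "i - 1"] excess_outer[of "i + 3"] excess_inner[of "i + 1"] edge zero
    by (simp_all add: add.commute[of _ i])
  have 2: "a (i + 1) = 1"
    using two_as_sum[OF 1(1)] inner_le_1 by blast
  hence 3: "a (i - 1) = 0" "a (i + 3) = 0" "b (i + 1) = 0" using 1 by (simp_all add: add.commute[of _ i])
  hence "b (i - 1) = 1" "b (i + 3) = 1"
    using 1 inner_le_1[of "i - 1"] outer_le_1[of "i - 2"]
      inner_le_1[of "i + 3"] outer_le_1[of "i + 4"] by linarith+
  thus False using 1(6) 2 by (simp add: add.commute[of _ i])
qed

text \<open>
  The positive values are now 1 and pairwise non-adjacent, so such a vertex has neighbourhood
  sum 0.
\<close>

lemma excess_eq_0_if_pos:
  "a i > 0 \<Longrightarrow> p (outer n i) = 0" "b i > 0 \<Longrightarrow> p (inner n i) = 0"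
proof -
  show "p (outer n i) = 0" if "a i > 0"
    using that excess_outer[of i] outer_le_1[of i] no_outer_edge[of i] no_outer_edge[of "i - 1"]
      no_spoke_edge[of i] by (simp add: add.commute[of _ i])
  show "p (inner n i) = 0" if "b i > 0"
    using that excess_inner[of i] inner_le_1[of i] no_inner_edge[of i] no_inner_edge[of "i - 2"]
      no_spoke_edge[of i] by (simp add: add.commute[of _ i])
qed

text \<open>
  A zero vertex of positive excess has three neighbours of value 1. By independence the
  outer vertex \<open>i + 2\<close> has value 0 and needs support from the outer vertex \<open>i + 3\<close>, which silences the
  inner vertex \<open>i + 3\<close>; the inner vertex \<open>i + 1\<close> is then dominated only once.
\<close>

lemma excess_outer_eq_0: "p (outer n i) = 0"
proof (rule ccontr)
  assume "p (outer n i) \<noteq> 0"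
  moreover from this have "a i = 0" using excess_eq_0_if_pos(1)[of i] by auto
  ultimately have full: "a (i - 1) = 1" "a (i + 1) = 1" "b i = 1"
    using excess_outer[of i] outer_le_1[of "i - 1"] outer_le_1[of "i + 1"] inner_le_1[of i] by linarith+
  have 0: "a (i + 2) = 0" "b (i - 1) = 0" "b (i + 1) = 0" "b (i + 2) = 0"
    using full no_outer_edge[of "i + 1"] no_spoke_edge[of "i - 1"] no_spoke_edge[of "i + 1"]
      no_inner_edge[of i] by (simp_all add: add.commute[of _ i])
  have "a (i + 3) > 0"
    using excess_outer[of "i + 2"] full 0 by (simp add: add.commute[of _ i])
  hence "b (i + 3) = 0" using no_spoke_edge[of "i + 3"] by (simp add: add.commute[of _ i])
  thus False using excess_inner[of "i + 1"] full 0 by (simp add: add.commute[of _ i])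
qed

text \<open>
  Independence empties the outer neighbours of the outer vertices \<open>i - 1\<close> and \<open>i + 1\<close>, except
  the outer vertex \<open>i\<close>; so both need their inner neighbours, but these are adjacent.
\<close>

lemma excess_inner_eq_0: "p (inner n i) = 0"
proof (rule ccontr)
  assume "p (inner n i) \<noteq> 0"
  moreover from this have "b i = 0" using excess_eq_0_if_pos(2)[of i] by auto
  ultimately have full: "b (i - 2) = 1" "b (i + 2) = 1" "a i = 1"
    using excess_inner[of i] inner_le_1[of "i - 2"] inner_le_1[of "i + 2"] outer_le_1[of i] by linarith+
  have 0: "a (i - 1) = 0" "a (i + 1) = 0" "a (i - 2) = 0" "a (i + 2) = 0"
    using full no_outer_edge[of "i - 1"] no_outer_edge[of i] no_spoke_edge[of "i - 2"]
      no_spoke_edge[of "i + 2"] by (simp_all add: add.commute[of _ i])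
  have "b (i - 1) > 0" "b (i + 1) > 0"
    using excess_outer[of "i - 1"] excess_outer[of "i + 1"] full 0 by (simp_all add: add.commute[of _ i])
  thus False using no_inner_edge[of "i - 1"] by (simp add: add.commute[of _ i])
qed

lemma total_excess_eq_0: "(\<Sum>v\<in>V. p v) = 0"
  using n excess_outer_eq_0 excess_inner_eq_0 by (auto simp: pverts_gen_petersen intro!: sum.neutral)

end

section \<open>An Italian dominating function of minimum weight\<close>

text \<open>
  In the periodic pattern only the columns congruent to 1 modulo 5 are empty, and every vertex has
  excess 0. The extra inner ones in the last two columns serve the columns next to the seam. If
  \<open>n \<equiv> 3\<close> modulo 5, the last column then needs no outer one, hence the exception at \<open>n - 1\<close>.
\<close>

definition outer_ones :: "nat \<Rightarrow> nat \<Rightarrow> bool" where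
  "outer_ones n i \<longleftrightarrow> i mod 5 = 0 \<or> i mod 5 = 2 \<and> i + 1 \<noteq> n"

definition inner_ones :: "nat \<Rightarrow> nat \<Rightarrow> bool" where
  "inner_ones n i \<longleftrightarrow> i mod 5 = 3 \<or> i mod 5 = 4 \<or> n \<le> i + 2"

definition optimal_idf :: "nat \<Rightarrow> nat \<Rightarrow> nat" where
  "optimal_idf n v = of_bool (if even v then outer_ones n (v div 2) else inner_ones n (v div 2))"

lemma optimal_idf_outer: "optimal_idf n (outer n i) = of_bool (outer_ones n (nat (i mod int n)))"
  by (simp add: optimal_idf_def outer_def)

lemma optimal_idf_inner: "optimal_idf n (inner n i) = of_bool (inner_ones n (nat (i mod int n)))"
  by (simp add: optimal_idf_def inner_def)

lemma nat_mod_diff: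
  assumes "i < n" "d \<le> n"
  shows "nat ((int i - int d) mod int n) = (if i < d then i + n - d else i - d)"
proof (cases "i < d")
  case True
  have "(int i - int d) mod int n = (int i - int d + int n) mod int n" by simp
  also have "int i - int d + int n = int (i + n - d)" using assms by simp
  finally show ?thesis using assms True by (simp flip: of_nat_mod)
next
  case False
  hence "int i - int d = int (i - d)" by simp
  thus ?thesis using assms False by (simp flip: of_nat_mod)
qed

lemma nat_mod_add:
  assumes "i < n" "d \<le> n"
  shows "nat ((int i + int d) mod int n) = (if i + d < n then i + d else i + d - n)"
  using assms by (simp add: le_mod_geq flip: of_nat_add of_nat_mod)

lemma outer_zero_dominated:
  assumes "5 \<le> n" "i < n" "\<not> outer_ones n i"
  shows "2 \<le> of_bool (outer_ones n (if i < 1 then i + n - 1 else i - 1)) +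
    of_bool (outer_ones n (if i + 1 < n then i + 1 else i + 1 - n)) + (of_bool (inner_ones n i) :: nat)"
proof -
  consider "i mod 5 = 1" | "i mod 5 = 3" | "i mod 5 = 4" | "i mod 5 = 2" "i + 1 = n"
    using assms(3) unfolding outer_ones_def by linarith
  thus ?thesis
  proof cases
    case 1
    have "i > 0" "(i - 1) mod 5 = 0" "(i + 1) mod 5 = 2"
      using 1 by (cases i; simp add: mod_Suc split: if_splits)+
    thus ?thesis using assms(2) by (auto simp: outer_ones_def inner_ones_def)
  next
    case 2
    have "i > 0" "(i - 1) mod 5 = 2" using 2 by (cases i; simp add: mod_Suc split: if_splits)+
    thus ?thesis using 2 assms(2) by (simp add: outer_ones_def inner_ones_def)
  next
    case 3
    have "(i + 1) mod 5 = 0" using 3 by (simp add: mod_Suc)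
    thus ?thesis using 3 assms(2) by (auto simp: outer_ones_def inner_ones_def)
  next
    case 4
    thus ?thesis by (simp add: outer_ones_def inner_ones_def)
  qed
qed

lemma inner_zero_dominated:
  assumes "5 \<le> n" "i < n" "\<not> inner_ones n i"
  shows "2 \<le> of_bool (inner_ones n (if i < 2 then i + n - 2 else i - 2)) +
    of_bool (inner_ones n (if i + 2 < n then i + 2 else i + 2 - n)) + (of_bool (outer_ones n i) :: nat)"
proof -
  have i: "i + 2 < n" using assms(3) by (simp add: inner_ones_def)
  consider "i = 0" | "i = 1" | "i \<ge> 2" "i mod 5 = 0" | "i \<ge> 2" "i mod 5 = 1" | "i mod 5 = 2"
    using assms(3) unfolding inner_ones_def by linarith
  thus ?thesis
  proof cases
    case 3
    obtain j where "i = Suc (Suc j)" using 3(1) that[of "i - 2"] by simp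
    hence "(i - 2) mod 5 = 3" using 3 by (simp add: mod_Suc split: if_splits)
    thus ?thesis using 3 i by (simp add: outer_ones_def inner_ones_def)
  next
    case 4
    obtain j where "i = Suc (Suc j)" using 4(1) that[of "i - 2"] by simp
    hence "(i - 2) mod 5 = 4" "(i + 2) mod 5 = 3" using 4 by (simp_all add: mod_Suc split: if_splits)
    thus ?thesis using 4 i by (simp add: inner_ones_def)
  next
    case 5
    have "(i + 2) mod 5 = 4" using 5 by (simp add: mod_Suc)
    thus ?thesis using 5 i by (simp add: outer_ones_def inner_ones_def)
  qed (use i in \<open>auto simp: outer_ones_def inner_ones_def\<close>)
qed

lemma optimal_idf_dominating:
  assumes "5 \<le> n"
  shows "italian_dominating (gen_petersen n 2) (optimal_idf n)"
  unfolding italian_dominating_def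
proof (intro conjI ballI impI)
  show "optimal_idf n \<in> pverts (gen_petersen n 2) \<rightarrow> {0, 1, 2}"
    by (auto simp: optimal_idf_def)
next
  fix v assume v: "v \<in> pverts (gen_petersen n 2)" and zero: "optimal_idf n v = 0"
  have n3: "3 \<le> n" and k: "0 < (2::nat)" "2 * 2 < n" using assms by simp_all
  define i where "i = v div 2"
  have i: "i < n" using v by (auto simp: gen_petersen_def i_def)
  have here: "nat (int i mod int n) = i" using i by simp
  have shift:
    "nat ((int i - 1) mod int n) = (if i < 1 then i + n - 1 else i - 1)"
    "nat ((int i + 1) mod int n) = (if i + 1 < n then i + 1 else i + 1 - n)"
    "nat ((int i - int 2) mod int n) = (if i < 2 then i + n - 2 else i - 2)"
    "nat ((int i + int 2) mod int n) = (if i + 2 < n then i + 2 else i + 2 - n)"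
    using assms nat_mod_diff[OF i, of 1] nat_mod_add[OF i, of 1]
    by (simp_all only: nat_mod_diff[OF i] nat_mod_add[OF i] of_nat_1)
  have "v = outer n (int i) \<or> v = inner n (int i)"
    unfolding outer_of_nat[OF i] inner_of_nat[OF i] unfolding i_def by presburger
  thus "2 \<le> (\<Sum>u\<in>open_nbhd (gen_petersen n 2) v. optimal_idf n u)"
  proof
    assume v: "v = outer n (int i)"
    have "\<not> outer_ones n i" using zero by (simp add: v optimal_idf_outer here)
    from outer_zero_dominated[OF assms i this] show ?thesis
      unfolding v sum_open_nbhd_outer[OF n3] optimal_idf_outer optimal_idf_inner here shift .
  next
    assume v: "v = inner n (int i)"
    have "\<not> inner_ones n i" using zero by (simp add: v optimal_idf_inner here)
    from inner_zero_dominated[OF assms i this] show ?thesis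
      unfolding v sum_open_nbhd_inner[OF k] optimal_idf_outer optimal_idf_inner here shift .
  qed
qed

lemma sum_pairs:
  fixes n :: nat and h :: "nat \<Rightarrow> nat"
  shows "(\<Sum>v<2 * n. h v) = (\<Sum>i<n. h (2 * i) + h (2 * i + 1))"
  by (induction n) simp_all

lemma mod_5_cases:
  fixes m :: nat
  obtains q where "m = 5 * q" | q where "m = 5 * q + 1" | q where "m = 5 * q + 2"
    | q where "m = 5 * q + 3" | q where "m = 5 * q + 4"
proof -
  have "m = 5 * (m div 5) + m mod 5" "m mod 5 < 5" by simp_all
  with that[of "m div 5"] show thesis by linarith
qed

text \<open>
  Before the last two columns, all columns have weight 1 except those congruent to 1 modulo 5,
  and \<open>(m + 3) div 5\<close> counts the latter below \<open>m\<close>.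
\<close>

lemma sum_not_1_mod_5: "(\<Sum>i<m. of_bool (i mod 5 \<noteq> 1)) + (m + 3) div 5 = (m :: nat)"
proof (induction m)
  case (Suc m)
  have "(Suc m + 3) div 5 = (m + 3) div 5 + of_bool (m mod 5 = 1)"
    by (cases m rule: mod_5_cases) (simp_all add: mod_Suc)
  with Suc show ?case by (simp add: of_bool_def)
qed simp

text \<open>
  The claimed value in natural number arithmetic: \<open>(4n + 4) div 5\<close> is \<open>4n/5\<close> rounded up.
\<close>

definition optimum :: "nat \<Rightarrow> nat" where
  "optimum n = (4 * n + 4) div 5 + of_bool (n mod 5 \<in> {1, 2})"

lemma weight_optimal_idf:
  assumes "5 \<le> n"
  shows "idf_weight (gen_petersen n 2) (optimal_idf n) = optimum n"
proof -
  obtain m where m: "n = Suc (Suc m)" using assms that[of "n - 2"] by simp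
  have "idf_weight (gen_petersen n 2) (optimal_idf n) =
      (\<Sum>i<n. of_bool (outer_ones n i) + of_bool (inner_ones n i))"
    by (simp add: idf_weight_def gen_petersen_def sum_pairs optimal_idf_def)
  also have "\<dots> = (\<Sum>i<m. of_bool (outer_ones n i) + of_bool (inner_ones n i)) +
      of_bool (outer_ones n m) + of_bool (inner_ones n m) +
      of_bool (outer_ones n (Suc m)) + of_bool (inner_ones n (Suc m))"
    unfolding m by simp
  also have "(\<Sum>i<m. of_bool (outer_ones n i) + of_bool (inner_ones n i)) =
      (\<Sum>i<m. of_bool (i mod 5 \<noteq> 1) :: nat)"
  proof (intro sum.cong refl)
    fix i assume "i \<in> {..<m}"
    moreover have "i mod 5 < 5" by simp
    ultimately show "of_bool (outer_ones n i) + of_bool (inner_ones n i) = (of_bool (i mod 5 \<noteq> 1) :: nat)"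
      unfolding outer_ones_def inner_ones_def m by auto
  qed
  also have "\<dots> = m - (m + 3) div 5"
    using sum_not_1_mod_5[of m] by simp
  also have "m - (m + 3) div 5 + of_bool (outer_ones n m) + of_bool (inner_ones n m) +
      of_bool (outer_ones n (Suc m)) + of_bool (inner_ones n (Suc m)) =
      m - (m + 3) div 5 + of_bool (m mod 5 = 0 \<or> m mod 5 = 2) + of_bool (m mod 5 = 4) + 2"
    unfolding outer_ones_def inner_ones_def m by (auto simp: mod_Suc)
  also have "\<dots> = optimum n"
    by (cases m rule: mod_5_cases) (simp_all add: optimum_def m mod_Suc)
  finally show ?thesis .
qed

section \<open>The Italian domination number\<close>

text \<open>
  Counting alone gives the rounded-up value. In the remaining residue classes the total excess is
  congruent to 1 or 2 modulo 5 and it is not 1 or 2, so it is at least 6, which raises the weight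
  by one.
\<close>

lemma optimum_le_weight:
  assumes "5 \<le> n" and f: "italian_dominating (gen_petersen n 2) f"
  shows "optimum n \<le> idf_weight (gen_petersen n 2) f"
proof -
  define e where "e = (\<Sum>v\<in>pverts (gen_petersen n 2). excess (gen_petersen n 2) f v)"
  have w: "5 * idf_weight (gen_petersen n 2) f = 4 * n + e"
    using five_times_weight[OF assms] by (simp add: e_def)
  show ?thesis
  proof (cases "n mod 5 \<in> {1, 2}")
    case True
    have "(e + 5 * n) mod 5 = (n + 5 * idf_weight (gen_petersen n 2) f) mod 5"
      using w by simp
    hence "e mod 5 = n mod 5" by simp
    moreover have "6 \<le> n" using True assms(1) by (cases "n = 5") auto
    hence "e = 0" if "e \<le> 2"
      using low_excess.total_excess_eq_0[of n f] that f by (simp add: low_excess_def e_def)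
    ultimately have "5 \<le> e"
      using True by (cases "e < 5") auto
    with w show ?thesis unfolding optimum_def using True by auto
  next
    case False
    with w show ?thesis unfolding optimum_def by auto
  qed
qed

lemma italian_domination_number_eq_optimum:
  assumes "5 \<le> n"
  shows "italian_domination_number (gen_petersen n 2) = optimum n"
  unfolding italian_domination_number_def
proof (rule Min_eqI)
  show "finite {idf_weight (gen_petersen n 2) f | f. italian_dominating (gen_petersen n 2) f}"
    by (rule finite_idf_weights) (simp add: gen_petersen_def)
  show "optimum n \<in> {idf_weight (gen_petersen n 2) f | f. italian_dominating (gen_petersen n 2) f}"
    using optimal_idf_dominating[OF assms] weight_optimal_idf[OF assms] by force
qed (use optimum_le_weight[OF assms] in auto)

theorem theorem8:
  fixes n :: nat
  assumes "n \<ge> 5"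
  shows "int (italian_domination_number (gen_petersen n 2)) =
    (if n mod 5 \<in> {0, 3, 4} then \<lceil>4 * real n / 5\<rceil> else \<lceil>4 * real n / 5\<rceil> + 1)"
proof -
  have "4 * n \<le> 5 * ((4 * n + 4) div 5)" "5 * ((4 * n + 4) div 5) < 4 * n + 5"
    by presburger+
  hence "4 * real n \<le> 5 * real ((4 * n + 4) div 5)" "5 * real ((4 * n + 4) div 5) < 4 * real n + 5"
    by linarith+
  hence "\<lceil>4 * real n / 5\<rceil> = int ((4 * n + 4) div 5)"
    by (intro ceiling_unique) auto
  moreover have "n mod 5 \<in> {1, 2} \<longleftrightarrow> n mod 5 \<notin> {0, 3, 4}"
    by auto
  ultimately show ?thesis
    by (simp add: italian_domination_number_eq_optimum[OF assms] optimum_def)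
qed

end
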